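(* Let $n \geq 4$ be an integer. Then the square $Q_n^2$ of the hypercube $Q_n$ is an imprimitive distance-transitive graph if and only if $n$ is an odd integer.
   Context: All graphs are finite, simple and undirected. The hypercube $Q_n$ is the graph with vertex set $\{0,1\}^n$ in which two $n$-tuples are adjacent if and only if they differ in precisely one coordinate. For a graph $\Gamma=(V,E)$, the square $\Gamma^2$ is the simple graph with vertex set $V$ in which two distinct vertices are adjacent if and only if their distance in $\Gamma$ is at most two. A graph $\Gamma$ is distance-transitive if for all vertices $u,v,x,y$ of $\Gamma$ with $d(u,v)=d(x,y)$ (graph distance in $\Gamma$) there is an automorphism $\pi$ of $\Gamma$ such that $\pi(u)=x$ and $\pi(v)=y$. A block in the action of a group $G$ on a set $X$ is a subset $B\subseteq X$ such that $B\cap g(B)\in\{B,\emptyset\}$ for each $g\in G$. If $G$ is transitive on $X$, the permutation group $(X,G)$ is primitive if the only blocks are the trivial ones, that is, those of cardinality $0$, $1$ or $|X|$; otherwise it is imprimitive. A graph $\Gamma$ is primitive (respectively imprimitive) if the group $\mathrm{Aut}(\Gamma)$ acting on $V(\Gamma)$ is primitive (respectively imprimitive). *)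

theory Defs
  imports "Graph_Theory.Graph_Theory" "HOL-Algebra.Group_Action"
begin

text \<open>
  A finite simple undirected graph is a \<open>'a pair_pre_digraph\<close> satisfying the locale predicate
  \<^const>\<open>pair_graph\<close>: the arc set is finite, irreflexive and symmetric, so an edge \<open>{u, v}\<close> is
  represented by the two arcs \<open>(u, v)\<close> and \<open>(v, u)\<close>.
\<close>

section \<open>Distance, squares and hypercubes\<close>

text \<open>Weighting every arc by 1, walk cost is walk length; the distance is \<open>\<infinity>\<close> if there is no walk.\<close>

definition graph_dist :: "'a pair_pre_digraph \<Rightarrow> 'a \<Rightarrow> 'a \<Rightarrow> ereal" where
  "graph_dist G u v = wf_digraph.\<mu> (with_proj G) (\<lambda>_. 1) u v"

definition graph_square :: "'a pair_pre_digraph \<Rightarrow> 'a pair_pre_digraph" where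
  "graph_square G =
     \<lparr> pverts = pverts G,
       parcs = {(u, v). u \<in> pverts G \<and> v \<in> pverts G \<and> u \<noteq> v \<and> graph_dist G u v \<le> 2} \<rparr>"

text \<open>The bits 0 and 1 are represented by \<^const>\<open>False\<close> and \<^const>\<open>True\<close>.\<close>

definition hypercube :: "nat \<Rightarrow> bool list pair_pre_digraph" where
  "hypercube n =
     \<lparr> pverts = {xs. length xs = n},
       parcs = {(xs, ys). length xs = n \<and> length ys = n \<and> (\<exists>!i. i < n \<and> xs ! i \<noteq> ys ! i)} \<rparr>"


section \<open>Automorphisms and distance-transitivity\<close>

definition graph_automorphisms :: "'a pair_pre_digraph \<Rightarrow> ('a \<Rightarrow> 'a) set" where
  "graph_automorphisms G =
     {f \<in> Bij (pverts G).
        \<forall>u \<in> pverts G. \<forall>v \<in> pverts G. (f u, f v) \<in> parcs G \<longleftrightarrow> (u, v) \<in> parcs G}"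

definition graph_Aut :: "'a pair_pre_digraph \<Rightarrow> ('a \<Rightarrow> 'a) monoid" where
  "graph_Aut G = BijGroup (pverts G) \<lparr> carrier := graph_automorphisms G \<rparr>"

definition distance_transitive :: "'a pair_pre_digraph \<Rightarrow> bool" where
  "distance_transitive G \<longleftrightarrow>
     (\<forall>u \<in> pverts G. \<forall>v \<in> pverts G. \<forall>x \<in> pverts G. \<forall>y \<in> pverts G.
        graph_dist G u v = graph_dist G x y \<longrightarrow>
        (\<exists>f \<in> graph_automorphisms G. f u = x \<and> f v = y))"


section \<open>Blocks and primitivity\<close>

definition is_block :: "('g, 'm) monoid_scheme \<Rightarrow> 'a set \<Rightarrow> ('g \<Rightarrow> 'a \<Rightarrow> 'a) \<Rightarrow> 'a set \<Rightarrow> bool" where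
  "is_block G E \<phi> B \<longleftrightarrow> B \<subseteq> E \<and> (\<forall>g \<in> carrier G. B \<inter> \<phi> g ` B \<in> {B, {}})"

text \<open>
  Primitivity and imprimitivity are only defined for transitive actions. The block sizes are
  measured by \<^const>\<open>card\<close>, so the two notions are meant for actions on finite sets.
\<close>

locale primitive_action = transitive_action +
  assumes block_trivial: "is_block G E \<phi> B \<Longrightarrow> card B \<in> {0, 1, card E}"

locale imprimitive_action = transitive_action +
  assumes not_primitive: "\<not> primitive_action G E \<phi>"

definition primitive_graph :: "'a pair_pre_digraph \<Rightarrow> bool" where
  "primitive_graph G \<longleftrightarrow> primitive_action (graph_Aut G) (pverts G) (\<lambda>f. f)"

definition imprimitive_graph :: "'a pair_pre_digraph \<Rightarrow> bool" where
  "imprimitive_graph G \<longleftrightarrow> imprimitive_action (graph_Aut G) (pverts G) (\<lambda>f. f)"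


section \<open>Well-formedness\<close>

lemma pair_graphI:
  assumes "finite (pverts G)" "parcs G \<subseteq> pverts G \<times> pverts G" "sym (parcs G)" "irrefl (parcs G)"
  shows "pair_graph G"
proof -
  have "finite (parcs G)"
    using assms(1,2) by (meson finite_SigmaI finite_subset)
  moreover have "fst e \<in> pverts G" "snd e \<in> pverts G" "fst e \<noteq> snd e" if "e \<in> parcs G" for e
    using assms(2,4) that by (cases e; auto simp: irrefl_def)+
  ultimately show ?thesis
    using assms(1,3) by unfold_locales (simp_all add: symmetric_def)
qed

lemma pair_graph_hypercube: "pair_graph (hypercube n)"
proof (rule pair_graphI)
  show "finite (pverts (hypercube n))"
    using finite_lists_length_eq[of "UNIV :: bool set" n] by (simp add: hypercube_def)
  show "parcs (hypercube n) \<subseteq> pverts (hypercube n) \<times> pverts (hypercube n)"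
    unfolding hypercube_def by clarsimp
  have "(\<exists>!i. i < n \<and> xs ! i \<noteq> ys ! i) = (\<exists>!i. i < n \<and> ys ! i \<noteq> xs ! i)" for xs ys :: "bool list"
    by (rule arg_cong[where f = Ex1]) auto
  then show "sym (parcs (hypercube n))"
    unfolding hypercube_def sym_def pair_pre_digraph.simps mem_Collect_eq case_prod_conv by blast
  show "irrefl (parcs (hypercube n))"
    by (simp add: hypercube_def irrefl_def Ex1_def)
qed

lemma graph_dist_commute:
  assumes "pair_graph G"
  shows "graph_dist G u v = graph_dist G v u"
proof -
  interpret pair_graph G by fact
  have le: "graph_dist G x y \<le> graph_dist G y x" for x y
    unfolding graph_dist_def \<mu>_def
  proof (rule INF_greatest)
    fix p assume "p \<in> {p. awalk y p x}"
    then have p: "awalk y p x" by simp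
    have "awalk x (rev (map prod.swap p)) y \<and> length (rev (map prod.swap p)) = length p"
      using p
    proof (induction p arbitrary: y)
      case (Cons e p)
      have "(snd e, fst e) \<in> parcs G"
        using Cons.prems pair_sym_arcs
        by (metis arcs_symmetric awalk_Cons_iff prod.collapse)
      then show ?case
        using Cons by (cases e) (auto simp: awalk_simps intro: in_arcsD1 in_arcsD2)
    qed (auto simp: awalk_Nil_iff)
    moreover have "awalk_cost (\<lambda>_. 1) q = real (length q)" for q :: "('a \<times> 'a) list"
      by (induction q) auto
    ultimately show "(INF p\<in>{p. awalk x p y}. ereal (awalk_cost (\<lambda>_. 1) p))
        \<le> ereal (awalk_cost (\<lambda>_. 1) p)"
      by (intro INF_lower2[of "rev (map prod.swap p)"]) auto
  qed
  show ?thesis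
    using le[of u v] le[of v u] by simp
qed

lemma pair_graph_square:
  assumes "pair_graph G"
  shows "pair_graph (graph_square G)"
proof (rule pair_graphI)
  interpret pair_graph G by fact
  show "finite (pverts (graph_square G))"
    by (simp add: graph_square_def pair_finite_verts)
  show "parcs (graph_square G) \<subseteq> pverts (graph_square G) \<times> pverts (graph_square G)"
    unfolding graph_square_def by clarsimp
  show "sym (parcs (graph_square G))"
  proof (rule symI)
    fix u v assume "(u, v) \<in> parcs (graph_square G)"
    then show "(v, u) \<in> parcs (graph_square G)"
      using graph_dist_commute[OF assms, of u v] by (auto simp: graph_square_def)
  qed
  show "irrefl (parcs (graph_square G))"
    by (simp add: graph_square_def irrefl_def)
qed

lemma group_action_graph_Aut: "group_action (graph_Aut G) (pverts G) (\<lambda>f. f)"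
proof -
  interpret B: group "BijGroup (pverts G)" by (rule group_BijGroup)
  have sub: "subgroup (graph_automorphisms G) (BijGroup (pverts G))"
  proof (rule B.subgroupI)
    show "graph_automorphisms G \<subseteq> carrier (BijGroup (pverts G))"
      by (auto simp: graph_automorphisms_def BijGroup_def)
    have "(\<lambda>x \<in> pverts G. x) \<in> graph_automorphisms G"
      by (auto simp: graph_automorphisms_def id_Bij)
    then show "graph_automorphisms G \<noteq> {}" by blast
  next
    fix f assume f: "f \<in> graph_automorphisms G"
    then have fB: "f \<in> Bij (pverts G)" by (simp add: graph_automorphisms_def)
    have inv: "inv_into (pverts G) f u \<in> pverts G \<and> f (inv_into (pverts G) f u) = u"
      if "u \<in> pverts G" for u
      using fB that by (metis Bij_def Bij_inv_into_mem Int_iff bij_betw_inv_into_right mem_Collect_eq)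
    show "inv\<^bsub>BijGroup (pverts G)\<^esub> f \<in> graph_automorphisms G"
      using f inv unfolding inv_BijGroup[OF fB] graph_automorphisms_def
      by (simp add: restrict_inv_into_Bij) (metis inv)
  next
    fix f g assume "f \<in> graph_automorphisms G" "g \<in> graph_automorphisms G"
    then show "f \<otimes>\<^bsub>BijGroup (pverts G)\<^esub> g \<in> graph_automorphisms G"
      using Bij_imp_funcset[of g "pverts G"]
      by (auto simp: graph_automorphisms_def BijGroup_def compose_Bij compose_eq Pi_iff)
  qed
  have "group (graph_Aut G)"
    unfolding graph_Aut_def by (rule B.subgroup_imp_group[OF sub])
  moreover have "(\<lambda>f. f) \<in> hom (graph_Aut G) (BijGroup (pverts G))"
    using subgroup.subset[OF sub] by (auto simp: hom_def graph_Aut_def)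
  ultimately show ?thesis
    by (intro group_action.intro group_hom.intro group_hom_axioms.intro group_BijGroup)
qed

end

theory Submission
  imports Defs
begin

text \<open>
  Appending a parity bit identifies \<open>Q_n\<^sup>2\<close> with the halved \<open>(n + 1)\<close>-cube: vertices become even
  subsets of \<open>{0, \<dots>, n}\<close>, and the distance is half the size of the symmetric difference. Hence all
  permutations of \<open>{0, \<dots>, n}\<close> act, in addition to translations, which gives
  distance-transitivity for every \<open>n\<close>. If \<open>n\<close> is odd, the antipode of \<open>x\<close> in \<open>Q_n\<close> is the only vertex
  at maximal distance \<open>(n + 1) / 2\<close> from \<open>x\<close>, so antipodal pairs are blocks. If \<open>n\<close> is even and a block
  contains two vertices at distance \<open>k\<close>, then by distance-transitivity it contains everything at
  distance \<open>k\<close> from one of them; as \<open>2k \<le> n\<close>, the Hamming spheres of radii \<open>2k - 1\<close> and \<open>2k\<close>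
  both lie there, so the block contains an edge and thus is everything by connectedness.
\<close>

section \<open>Distances and automorphisms\<close>

text \<open>Along a walk from \<open>u\<close> the value grows by at most one per arc, so
  \<open>d\<close> bounds walk lengths from below. Descending through strictly smaller predecessors
  builds a walk of length at most \<open>d v\<close>. Later distance computations thus avoid walks
  and infima.\<close>

lemma graph_dist_eqI:
  fixes d :: "'a \<Rightarrow> nat"
  assumes wf: "pair_wf_digraph G" and u: "u \<in> pverts G" and v: "v \<in> pverts G"
    and zero: "\<And>v. v \<in> pverts G \<Longrightarrow> d v = 0 \<longleftrightarrow> v = u"
    and step: "\<And>v w. (v, w) \<in> parcs G \<Longrightarrow> d w \<le> d v + 1"
    and pred: "\<And>v. v \<in> pverts G \<Longrightarrow> 0 < d v \<Longrightarrow> \<exists>w. (w, v) \<in> parcs G \<and> d w < d v"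
  shows "graph_dist G u v = ereal (real (d v))"
proof -
  interpret pair_wf_digraph G by (fact wf)
  have cost: "awalk_cost (\<lambda>_. 1) q = real (length q)" for q :: "('a \<times> 'a) list"
    by (induction q) auto
  have lower: "d y \<le> d x + length p" if "awalk x p y" for x y p
    using that
  proof (induction p arbitrary: x)
    case (Cons e p)
    then have "d (snd e) \<le> d x + 1" "d y \<le> d (snd e) + length p"
      using step[of x "snd e"] by (auto simp: awalk_simps)
    then show ?case by simp
  qed (auto simp: awalk_Nil_iff)
  have upper: "\<exists>p. awalk u p x \<and> length p \<le> d x" if "x \<in> pverts G" for x
    using that
  proof (induction "d x" arbitrary: x rule: less_induct)
    case less
    show ?case
    proof (cases "d x = 0")
      case True
      then show ?thesis
        using zero less.prems u by (intro exI[of _ "[]"]) (auto simp: awalk_Nil_iff)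
    next
      case False
      then obtain w where w: "(w, x) \<in> parcs G" "d w < d x"
        using pred less.prems by blast
      then obtain p where "awalk u p w" "length p \<le> d w"
        using less.hyps in_arcsD1 by blast
      moreover have "awalk w [(w, x)] x"
        using w less.prems by (auto simp: awalk_simps)
      ultimately show ?thesis
        using w by (intro exI[of _ "p @ [(w, x)]"]) (auto intro: awalk_appendI simp del: awalk_append_iff)
    qed
  qed
  obtain p where p: "awalk u p v" "length p \<le> d v"
    using upper v by blast
  show ?thesis
    unfolding graph_dist_def \<mu>_def
  proof (rule antisym)
    show "(INF p\<in>{p. awalk u p v}. ereal (awalk_cost (\<lambda>_. 1) p)) \<le> ereal (real (d v))"
      using p by (intro INF_lower2[of p]) (auto simp: cost)
    show "ereal (real (d v)) \<le> (INF p\<in>{p. awalk u p v}. ereal (awalk_cost (\<lambda>_. 1) p))"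
      using lower[of u _ v] zero[OF u] by (intro INF_greatest) (auto simp: cost)
  qed
qed

lemma graph_automorphismsD:
  assumes "f \<in> graph_automorphisms G"
  shows "bij_betw f (pverts G) (pverts G)"
    and "u \<in> pverts G \<Longrightarrow> v \<in> pverts G \<Longrightarrow> (f u, f v) \<in> parcs G \<longleftrightarrow> (u, v) \<in> parcs G"
  using assms by (auto simp: graph_automorphisms_def Bij_def)

text \<open>Members of \<open>Bij\<close> are extensional, hence the restriction; surjectivity
  follows from injectivity on a finite set.\<close>

lemma restrict_in_graph_automorphisms:
  assumes "finite (pverts G)" "f ` pverts G \<subseteq> pverts G" "inj_on f (pverts G)"
    and "\<And>u v. u \<in> pverts G \<Longrightarrow> v \<in> pverts G \<Longrightarrow> (f u, f v) \<in> parcs G \<longleftrightarrow> (u, v) \<in> parcs G"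
  shows "restrict f (pverts G) \<in> graph_automorphisms G"
  using assms endo_inj_surj[OF assms(1-3)]
  by (auto simp: graph_automorphisms_def Bij_def bij_betw_def inj_on_restrict_eq)

section \<open>Hamming distance\<close>

text \<open>Indices range over the first list only, so symmetry needs equal lengths.\<close>

definition hamming :: "bool list \<Rightarrow> bool list \<Rightarrow> nat" where
  "hamming xs ys = card {i. i < length xs \<and> xs ! i \<noteq> ys ! i}"

lemma hamming_le: "hamming xs ys \<le> length xs"
  unfolding hamming_def using card_mono[of "{..<length xs}" "{i. i < length xs \<and> xs ! i \<noteq> ys ! i}"]
  by auto

lemma hamming_eq_0_iff: "length xs = length ys \<Longrightarrow> hamming xs ys = 0 \<longleftrightarrow> xs = ys"
  by (auto simp: hamming_def list_eq_iff_nth_eq)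

lemma hamming_commute: "length xs = length ys \<Longrightarrow> hamming xs ys = hamming ys xs"
  by (auto simp: hamming_def intro: arg_cong[where f = card])

lemma hamming_triangle:
  assumes "length xs = length ys"
  shows "hamming xs zs \<le> hamming xs ys + hamming ys zs"
proof -
  have "hamming xs zs \<le> card ({i. i < length xs \<and> xs ! i \<noteq> ys ! i} \<union> {i. i < length ys \<and> ys ! i \<noteq> zs ! i})"
    unfolding hamming_def using assms by (intro card_mono) auto
  also have "\<dots> \<le> hamming xs ys + hamming ys zs"
    unfolding hamming_def by (rule card_Un_le)
  finally show ?thesis .
qed

text \<open>Complementing \<open>xs\<close> exchanges the positions of agreement and disagreement
  with \<open>ys\<close>.\<close>

lemma hamming_map_Not_left: "length xs = length ys \<Longrightarrow> hamming (map Not xs) ys + hamming xs ys = length xs"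
proof -
  assume "length xs = length ys"
  have "hamming (map Not xs) ys + hamming xs ys =
      card ({i. i < length xs \<and> xs ! i = ys ! i} \<union> {i. i < length xs \<and> xs ! i \<noteq> ys ! i})"
    unfolding hamming_def by (subst card_Un_disjoint) (auto intro: arg_cong[where f = card])
  also have "{i. i < length xs \<and> xs ! i = ys ! i} \<union> {i. i < length xs \<and> xs ! i \<noteq> ys ! i} = {..<length xs}"
    by auto
  finally show ?thesis by simp
qed

lemma hamming_eq_length_iff:
  assumes "length xs = length ys"
  shows "hamming xs ys = length xs \<longleftrightarrow> ys = map Not xs"
proof -
  have "hamming xs ys = length xs \<longleftrightarrow> hamming (map Not xs) ys = 0"
    using hamming_map_Not_left[OF assms] by linarith
  also have "\<dots> \<longleftrightarrow> map Not xs = ys"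
    using assms by (intro hamming_eq_0_iff) simp
  finally show ?thesis by (simp only: eq_commute)
qed

text \<open>Hamming geodesics: overwriting \<open>j\<close> of the disagreeing positions of
  \<open>xs\<close> by the entries of \<open>ys\<close> gives the intermediate point.\<close>

lemma hamming_between:
  assumes "length xs = length ys" "j \<le> hamming xs ys"
  shows "\<exists>zs. length zs = length xs \<and> hamming xs zs = j \<and> hamming zs ys = hamming xs ys - j"
proof -
  let ?D = "{i. i < length xs \<and> xs ! i \<noteq> ys ! i}"
  obtain T where T: "T \<subseteq> ?D" "card T = j" "finite T"
    using obtain_subset_with_card_n[of j ?D] assms(2) by (auto simp: hamming_def)
  define zs where "zs = map (\<lambda>i. if i \<in> T then ys ! i else xs ! i) [0..<length xs]"
  have "{i. i < length xs \<and> xs ! i \<noteq> zs ! i} = T"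
    using T by (auto simp: zs_def)
  moreover have "{i. i < length zs \<and> zs ! i \<noteq> ys ! i} = ?D - T"
    using T by (auto simp: zs_def)
  moreover have "card (?D - T) = card ?D - j"
    using T by (simp add: card_Diff_subset)
  ultimately show ?thesis
    using T by (intro exI[of _ zs]) (auto simp: hamming_def zs_def)
qed

text \<open>The geodesic from \<open>xs\<close> to its complement passes through every
  radius.\<close>

lemma ex_hamming_eq:
  assumes "j \<le> length xs"
  shows "\<exists>zs. length zs = length xs \<and> hamming xs zs = j"
  using hamming_between[of xs "map Not xs" j] hamming_eq_length_iff[of xs "map Not xs"] assms by auto

section \<open>The square of the hypercube\<close>

lemma pverts_hypercube [simp]: "pverts (hypercube n) = {xs. length xs = n}"
  by (simp add: hypercube_def)

lemma parcs_hypercube: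
  "(xs, ys) \<in> parcs (hypercube n) \<longleftrightarrow> length xs = n \<and> length ys = n \<and> hamming xs ys = 1"
proof -
  have "(\<exists>!i. P i) \<longleftrightarrow> card {i. P i} = 1" for P :: "nat \<Rightarrow> bool"
    by (auto simp: card_1_singleton_iff Ex1_def set_eq_iff)
  then show ?thesis
    by (auto simp: hypercube_def hamming_def)
qed

lemma graph_dist_hypercube:
  assumes "length xs = n" "length ys = n"
  shows "graph_dist (hypercube n) xs ys = ereal (real (hamming xs ys))"
proof (rule graph_dist_eqI)
  interpret pair_graph "hypercube n" by (rule pair_graph_hypercube)
  show "pair_wf_digraph (hypercube n)" by unfold_locales
next
  fix v w assume "(v, w) \<in> parcs (hypercube n)"
  then show "hamming xs w \<le> hamming xs v + 1"
    using hamming_triangle[of xs v w] assms by (simp add: parcs_hypercube)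
next
  fix v assume "v \<in> pverts (hypercube n)" "0 < hamming xs v"
  then show "\<exists>w. (w, v) \<in> parcs (hypercube n) \<and> hamming xs w < hamming xs v"
    using hamming_between[of xs v "hamming xs v - 1"] assms by (auto simp: parcs_hypercube)
qed (use assms in \<open>auto simp: hamming_eq_0_iff\<close>)

text \<open>Half the Hamming distance rounded up, since one step in the square flips at most two
  bits.\<close>

definition square_dist :: "bool list \<Rightarrow> bool list \<Rightarrow> nat" where
  "square_dist xs ys = (hamming xs ys + 1) div 2"

abbreviation "hypercube_square n \<equiv> graph_square (hypercube n)"

lemma square_dist_eq_0_iff: "length xs = length ys \<Longrightarrow> square_dist xs ys = 0 \<longleftrightarrow> xs = ys"
  using hamming_eq_0_iff[of xs ys] by (auto simp: square_dist_def)

lemma square_dist_commute: "length xs = length ys \<Longrightarrow> square_dist xs ys = square_dist ys xs"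
  by (simp add: square_dist_def hamming_commute)

lemma pverts_hypercube_square [simp]: "pverts (hypercube_square n) = {xs. length xs = n}"
  by (simp add: graph_square_def)

lemma finite_pverts_hypercube_square: "finite (pverts (hypercube_square n))"
  using finite_lists_length_eq[of "UNIV :: bool set" n] by simp

lemma parcs_hypercube_square:
  "(xs, ys) \<in> parcs (hypercube_square n) \<longleftrightarrow> length xs = n \<and> length ys = n \<and> square_dist xs ys = 1"
  using hamming_eq_0_iff[of xs ys] hamming_eq_0_iff[of xs xs]
  by (cases "length xs = n \<and> length ys = n")
    (auto simp: graph_square_def graph_dist_hypercube square_dist_def)

lemma square_dist_triangle:
  assumes "length xs = n" "(v, w) \<in> parcs (hypercube_square n)"
  shows "square_dist xs w \<le> square_dist xs v + 1"
proof -
  have "hamming v w \<le> 2" "length v = n"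
    using assms(2) by (auto simp: parcs_hypercube_square square_dist_def)
  then show ?thesis
    using hamming_triangle[of xs v w] assms(1) unfolding square_dist_def by linarith
qed

lemma square_dist_pred:
  assumes "length xs = n" "length v = n" "0 < square_dist xs v"
  shows "\<exists>w. (w, v) \<in> parcs (hypercube_square n) \<and> square_dist xs w < square_dist xs v"
proof -
  have pos: "0 < hamming xs v"
    using assms(3) by (cases "hamming xs v") (auto simp: square_dist_def)
  \<comment> \<open>Go back two flips on a geodesic; at Hamming distance 1 truncated subtraction
    gives \<open>w = xs\<close>.\<close>
  obtain w where w: "length w = n" "hamming xs w = hamming xs v - 2"
      "hamming w v = hamming xs v - (hamming xs v - 2)"
    using hamming_between[of xs v "hamming xs v - 2"] assms by auto
  then have "hamming w v = 1 \<or> hamming w v = 2"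
    using pos by linarith
  moreover have "square_dist xs w < square_dist xs v"
    using w assms(3) unfolding square_dist_def by presburger
  ultimately show ?thesis
    using w assms by (intro exI[of _ w]) (auto simp: parcs_hypercube_square square_dist_def)
qed

lemma pair_wf_digraph_hypercube_square: "pair_wf_digraph (hypercube_square n)"
proof -
  interpret pair_graph "hypercube_square n"
    by (rule pair_graph_square[OF pair_graph_hypercube])
  show ?thesis by unfold_locales
qed

lemma graph_dist_hypercube_square:
  assumes "length xs = n" "length ys = n"
  shows "graph_dist (hypercube_square n) xs ys = ereal (real (square_dist xs ys))"
  by (rule graph_dist_eqI[OF pair_wf_digraph_hypercube_square])
    (use assms square_dist_triangle square_dist_pred in \<open>auto simp: square_dist_eq_0_iff\<close>)

text \<open>Both sides compute the graph distance from \<open>xs\<close> to \<open>ys\<close>: the axioms of a distance function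
  are invariant under automorphisms.\<close>

lemma square_dist_automorphism:
  assumes f: "f \<in> graph_automorphisms (hypercube_square n)"
    and xs: "length xs = n" and ys: "length ys = n"
  shows "square_dist (f xs) (f ys) = square_dist xs ys"
proof -
  have len: "length (f v) = n" if "length v = n" for v
    using bij_betwE[OF graph_automorphismsD(1)[OF f]] that by auto
  have "graph_dist (hypercube_square n) xs ys = ereal (real (square_dist (f xs) (f ys)))"
  proof (rule graph_dist_eqI[OF pair_wf_digraph_hypercube_square])
    fix v assume v: "v \<in> pverts (hypercube_square n)"
    show "square_dist (f xs) (f v) = 0 \<longleftrightarrow> v = xs"
      using bij_betw_imp_inj_on[OF graph_automorphismsD(1)[OF f]] v xs
      by (auto simp: square_dist_eq_0_iff len dest: inj_onD)
    assume "0 < square_dist (f xs) (f v)"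
    then obtain w where w: "(w, f v) \<in> parcs (hypercube_square n)"
        "square_dist (f xs) w < square_dist (f xs) (f v)"
      using square_dist_pred[of "f xs" n "f v"] xs v by (auto simp: len)
    \<comment> \<open>Surjectivity of \<open>f\<close> pulls the closer neighbour of
      \<open>f v\<close> back to one of \<open>v\<close>.\<close>
    then have "w \<in> f ` pverts (hypercube_square n)"
      using bij_betw_imp_surj_on[OF graph_automorphismsD(1)[OF f]]
      by (auto simp: parcs_hypercube_square)
    then obtain w' where "w = f w'" "w' \<in> pverts (hypercube_square n)" by blast
    then show "\<exists>w. (w, v) \<in> parcs (hypercube_square n) \<and>
        square_dist (f xs) (f w) < square_dist (f xs) (f v)"
      using w v graph_automorphismsD(2)[OF f] by blast
  next
    fix v w assume "(v, w) \<in> parcs (hypercube_square n)"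
    then have "(f v, f w) \<in> parcs (hypercube_square n)"
      using graph_automorphismsD(2)[OF f, of v w] by (simp add: parcs_hypercube_square)
    then show "square_dist (f xs) (f w) \<le> square_dist (f xs) (f v) + 1"
      by (rule square_dist_triangle[OF len[OF xs]])
  qed (use xs ys in auto)
  then show ?thesis
    using graph_dist_hypercube_square[OF xs ys] by simp
qed

section \<open>Distance-transitivity\<close>

definition parity_set :: "bool list \<Rightarrow> nat set" where
  "parity_set xs = {i. i < length xs \<and> xs ! i} \<union>
     (if odd (card {i. i < length xs \<and> xs ! i}) then {length xs} else {})"

lemma parity_set_subset: "parity_set xs \<subseteq> {..length xs}"
  by (auto simp: parity_set_def)

lemma finite_parity_set: "finite (parity_set xs)"
  using parity_set_subset finite_subset by blast

lemma even_card_parity_set: "even (card (parity_set xs))"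
  by (simp add: parity_set_def)

text \<open>Every even subset is an encoding: decoding forgets \<open>n\<close>, and evenness
  recovers whether \<open>n\<close> belongs to \<open>S\<close>.\<close>

lemma parity_set_map:
  assumes S: "S \<subseteq> {..n}" "even (card S)"
  shows "parity_set (map (\<lambda>i. i \<in> S) [0..<n]) = S"
proof -
  have fin: "finite S"
    using S(1) finite_subset by blast
  have eq: "{i. i < n \<and> map (\<lambda>i. i \<in> S) [0..<n] ! i} = S - {n}"
    using S(1) by (auto simp: nat_less_le)
  have "card S = Suc (card (S - {n}))" if "n \<in> S"
    using card.remove[OF fin that] by linarith
  moreover have "S - {n} = S" if "n \<notin> S"
    using that by simp
  ultimately have "odd (card (S - {n})) \<longleftrightarrow> n \<in> S"
    using S(2) by (metis even_Suc)
  then show ?thesis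
    unfolding parity_set_def by (auto simp: eq)
qed

lemma even_card_sym_diff:
  assumes "finite A" "finite B"
  shows "even (card (sym_diff A B)) \<longleftrightarrow> (even (card A) \<longleftrightarrow> even (card B))"
proof -
  have "card (sym_diff A B) = card (A - B) + card (B - A)"
    using assms by (intro card_Un_disjoint) auto
  moreover have "card A = card (A - B) + card (A \<inter> B)" "card B = card (B - A) + card (A \<inter> B)"
    using assms card_Int_Diff[of A B] card_Int_Diff[of B A] by (simp_all add: Int_commute)
  ultimately show ?thesis by presburger
qed

text \<open>Below the parity index the symmetric difference counts the Hamming distance; the parity
  index rounds this up to an even number. In particular the encoding is injective on lists of equal
  length.\<close>

lemma card_sym_diff_parity_set:
  assumes "length xs = length ys"
  shows "card (sym_diff (parity_set xs) (parity_set ys)) = 2 * square_dist xs ys"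
proof -
  let ?n = "length xs" and ?S = "sym_diff (parity_set xs) (parity_set ys)"
  have fin: "finite ?S"
    by (simp add: finite_parity_set)
  have "?S - {?n} = {i. i < ?n \<and> xs ! i \<noteq> ys ! i}"
    using assms by (auto simp: parity_set_def)
  then have "hamming xs ys = card (?S - {?n})"
    by (simp add: hamming_def)
  moreover have "even (card ?S)"
    using even_card_parity_set finite_parity_set even_card_sym_diff by blast
  moreover have "card ?S = card (?S - {?n}) \<or> card ?S = Suc (card (?S - {?n}))"
    using fin card.remove[of ?S ?n] by (cases "?n \<in> ?S") auto
  ultimately show ?thesis
    unfolding square_dist_def by presburger
qed

text \<open>The complements of \<open>A\<close> and \<open>B\<close> in \<open>U\<close> also have
  equal size, so two bijections can be glued.\<close>

lemma ex_bij_betw_image_eq: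
  assumes "finite U" "A \<subseteq> U" "B \<subseteq> U" "card A = card B"
  shows "\<exists>\<sigma>. bij_betw \<sigma> U U \<and> \<sigma> ` A = B"
proof -
  have fin: "finite A" "finite B"
    using assms finite_subset by auto
  obtain g where g: "bij_betw g A B"
    using finite_same_card_bij[OF fin assms(4)] by blast
  obtain h where h: "bij_betw h (U - A) (U - B)"
    using finite_same_card_bij[of "U - A" "U - B"] assms fin by (auto simp: card_Diff_subset)
  have "bij_betw (\<lambda>i. if i \<in> A then g i else h i) (A \<union> (U - A)) (B \<union> (U - B))"
    using g h by (intro bij_betw_disjoint_Un) auto
  moreover have "A \<union> (U - A) = U" "B \<union> (U - B) = U"
    using assms by auto
  moreover have "(\<lambda>i. if i \<in> A then g i else h i) ` A = B"
    using bij_betw_imp_surj_on[OF g] by auto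
  ultimately show ?thesis by metis
qed

lemma sym_diff_image:
  assumes "inj_on \<sigma> U" "A \<subseteq> U" "B \<subseteq> U"
  shows "\<sigma> ` sym_diff A B = sym_diff (\<sigma> ` A) (\<sigma> ` B)"
  using inj_on_image_set_diff[OF assms(1), of A B] inj_on_image_set_diff[OF assms(1), of B A] assms(2,3)
  by (simp add: image_Un Diff_subset[THEN subset_trans])

text \<open>On encodings: translate \<open>u\<close> to the empty set, permute all
  \<open>n + 1\<close> indices, then translate the empty set to \<open>x\<close>. Each step
  preserves evenness and the sizes of symmetric differences.\<close>

lemma ex_square_automorphism:
  assumes len: "length u = n" "length v = n" "length x = n" "length y = n"
    and dist: "square_dist u v = square_dist x y"
  shows "\<exists>f \<in> graph_automorphisms (hypercube_square n). f u = x \<and> f v = y"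
proof -
  let ?V = "pverts (hypercube_square n)"
  have sub: "sym_diff (parity_set w) (parity_set z) \<subseteq> {..n}" if "length w = n" "length z = n" for w z
    using parity_set_subset[of w] parity_set_subset[of z] that by auto
  \<comment> \<open>The two differences have equal size, twice the common distance. The permutation
    may move the parity index.\<close>
  obtain \<sigma> where \<sigma>: "bij_betw \<sigma> {..n} {..n}"
      "\<sigma> ` sym_diff (parity_set v) (parity_set u) = sym_diff (parity_set y) (parity_set x)"
  proof -
    have "card (sym_diff (parity_set v) (parity_set u)) = card (sym_diff (parity_set y) (parity_set x))"
      using card_sym_diff_parity_set[of v u] card_sym_diff_parity_set[of y x] len dist
      by (metis square_dist_commute)
    then show ?thesis
      using ex_bij_betw_image_eq[OF finite_atMost sub[OF len(2,1)] sub[OF len(4,3)]] that by blast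
  qed
  have inj: "inj_on \<sigma> {..n}"
    using \<sigma>(1) by (rule bij_betw_imp_inj_on)
  define g where "g w = \<sigma> ` sym_diff (parity_set w) (parity_set u)" for w
  define F where "F w = sym_diff (parity_set x) (g w)" for w
  define f where "f w = map (\<lambda>i. i \<in> F w) [0..<n]" for w
  have g_sub: "g w \<subseteq> {..n}" if "length w = n" for w
    using image_mono[OF sub[OF that len(1)], of \<sigma>] bij_betw_imp_surj_on[OF \<sigma>(1)]
    by (simp add: g_def)
  have card_image_\<sigma>: "card (\<sigma> ` sym_diff (parity_set w) (parity_set z)) = 2 * square_dist w z"
    if "length w = n" "length z = n" for w z
    using card_image[OF inj_on_subset[OF inj sub[OF that]]] card_sym_diff_parity_set that by simp
  have len_f: "length (f w) = n" for w
    by (simp add: f_def)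
  have parity_f: "parity_set (f w) = F w" if "length w = n" for w
    unfolding f_def
  proof (rule parity_set_map)
    show "F w \<subseteq> {..n}"
      using parity_set_subset[of x] g_sub[OF that] len by (auto simp: F_def)
    have "even (card (g w))"
      using card_image_\<sigma>[OF that len(1)] by (simp add: g_def)
    moreover have "finite (g w)"
      using g_sub[OF that] finite_subset by blast
    ultimately show "even (card (F w))"
      using even_card_sym_diff[OF finite_parity_set, of "g w" x] even_card_parity_set[of x]
      unfolding F_def by simp
  qed
  have f_dist: "square_dist (f w) (f z) = square_dist w z" if "length w = n" "length z = n" for w z
  proof -
    \<comment> \<open>Both translations cancel in symmetric differences, leaving only the
      permutation, which preserves size.\<close>
    have "sym_diff (F w) (F z) = sym_diff (g w) (g z)"
      unfolding F_def by blast
    also have "\<dots> = \<sigma> ` sym_diff (sym_diff (parity_set w) (parity_set u)) (sym_diff (parity_set z) (parity_set u))"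
      unfolding g_def using sub that len by (intro sym_diff_image[OF inj, symmetric]) auto
    also have "sym_diff (sym_diff (parity_set w) (parity_set u)) (sym_diff (parity_set z) (parity_set u)) =
        sym_diff (parity_set w) (parity_set z)"
      by blast
    finally show ?thesis
      using card_sym_diff_parity_set[of "f w" "f z"] card_image_\<sigma>[OF that] that
      by (simp add: parity_f len_f)
  qed
  \<comment> \<open>Equal encodings mean distance zero, hence equal lists.\<close>
  have eqI: "f w = z" if "length w = n" "length z = n" "F w = parity_set z" for w z
    using card_sym_diff_parity_set[of "f w" z] square_dist_eq_0_iff[of "f w" z] that
    by (simp add: parity_f len_f)
  have "restrict f ?V \<in> graph_automorphisms (hypercube_square n)"
  proof (rule restrict_in_graph_automorphisms[OF finite_pverts_hypercube_square])
    show "inj_on f ?V"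
    proof (rule inj_onI)
      fix w z assume "w \<in> ?V" "z \<in> ?V" "f w = f z"
      then show "w = z"
        using f_dist[of w z] square_dist_eq_0_iff[of w z] square_dist_eq_0_iff[of "f w" "f z"]
        by simp
    qed
  qed (auto simp: len_f f_dist parcs_hypercube_square)
  moreover have "f u = x"
    by (rule eqI) (auto simp: len F_def g_def)
  moreover have "f v = y"
    by (rule eqI) (use \<sigma>(2) len in \<open>auto simp: F_def g_def\<close>)
  ultimately show ?thesis
    using len by (intro bexI[of _ "restrict f ?V"]) auto
qed

lemma distance_transitive_hypercube_square: "distance_transitive (hypercube_square n)"
  unfolding distance_transitive_def
  by (auto simp: graph_dist_hypercube_square intro: ex_square_automorphism)

section \<open>Blocks\<close>

lemma carrier_graph_Aut [simp]: "carrier (graph_Aut G) = graph_automorphisms G"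
  by (simp add: graph_Aut_def)

lemma transitive_action_hypercube_square:
  "transitive_action (graph_Aut (hypercube_square n)) (pverts (hypercube_square n)) (\<lambda>f. f)"
proof (intro transitive_action.intro transitive_action_axioms.intro group_action_graph_Aut)
  fix x y assume "x \<in> pverts (hypercube_square n)" "y \<in> pverts (hypercube_square n)"
  \<comment> \<open>Transitivity is the case of distance zero.\<close>
  then show "\<exists>g\<in>carrier (graph_Aut (hypercube_square n)). g x = y"
    using ex_square_automorphism[of x n x y y] by (auto simp: square_dist_eq_0_iff[THEN iffD2])
qed

lemma block_closed_square_dist:
  assumes B: "is_block (graph_Aut (hypercube_square n)) (pverts (hypercube_square n)) (\<lambda>f. f) B"
    and "x \<in> B" "y \<in> B" "length z = n" "square_dist x z = square_dist x y"
  shows "z \<in> B"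
proof -
  have "B \<subseteq> pverts (hypercube_square n)"
    using B by (simp add: is_block_def)
  then have len: "length w = n" if "w \<in> B" for w
    using that by auto
  \<comment> \<open>Sending \<open>z\<close> to \<open>y\<close>, not \<open>y\<close> to
    \<open>z\<close>, makes the inclusion of \<open>B\<close> in its image suffice.\<close>
  obtain f where f: "f \<in> graph_automorphisms (hypercube_square n)" "f x = x" "f z = y"
    using ex_square_automorphism[of x n z x y] assms len by auto
  have "B \<inter> f ` B \<noteq> {}"
    using f assms by force
  then have "B \<subseteq> f ` B"
    using B f(1) by (auto simp: is_block_def)
  then obtain b where b: "b \<in> B" "f b = f z"
    using assms f by force
  then have "b = z"
    using bij_betw_imp_inj_on[OF graph_automorphismsD(1)[OF f(1)]] len assms by (auto dest: inj_onD)
  with b show ?thesis by simp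
qed

lemma primitive_hypercube_square_even:
  assumes "even n"
  shows "primitive_graph (hypercube_square n)"
  unfolding primitive_graph_def
proof (intro primitive_action.intro transitive_action_hypercube_square primitive_action_axioms.intro)
  let ?V = "pverts (hypercube_square n)"
  fix B assume B: "is_block (graph_Aut (hypercube_square n)) ?V (\<lambda>f. f) B"
  then have sub: "B \<subseteq> ?V"
    by (simp add: is_block_def)
  have len: "length w = n" if "w \<in> B" for w
    using sub that by auto
  have fin: "finite B"
    using sub finite_pverts_hypercube_square finite_subset by blast
  show "card B \<in> {0, 1, card ?V}"
  proof (cases "card B \<le> 1")
    case True
    then show ?thesis by auto
  next
    case False
    then obtain x y where xy: "x \<in> B" "y \<in> B" "x \<noteq> y"
      using fin card_le_Suc0_iff_eq[OF fin] by (metis One_nat_def)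
    define k where "k = square_dist x y"
    \<comment> \<open>Evenness of \<open>n\<close> matters here: half of a number at most
      \<open>n\<close>, rounded up, is at most \<open>n div 2\<close>.\<close>
    have k: "0 < k" "2 * k \<le> n"
      using xy len square_dist_eq_0_iff[of x y] hamming_le[of x y] \<open>even n\<close>
      by (auto simp: k_def square_dist_def elim!: evenE)
    obtain z where z: "length z = n" "hamming x z = 2 * k"
      using ex_hamming_eq[of "2 * k" x] k len xy by auto
    \<comment> \<open>The last point before \<open>z\<close> on a geodesic from \<open>x\<close>;
      both \<open>2 * k - 1\<close> and \<open>2 * k\<close> round to \<open>k\<close>.\<close>
    obtain z' where z': "length z' = n" "hamming x z' = 2 * k - 1" "hamming z' z = 1"
      using hamming_between[of x z "2 * k - 1"] z k len xy by auto
    have zB: "z \<in> B" "z' \<in> B"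
      using block_closed_square_dist[OF B xy(1,2)] z z' k by (auto simp: k_def square_dist_def)
    have edge: "square_dist z z' = 1"
      using z z' hamming_commute[of z z'] by (simp add: square_dist_def)
    \<comment> \<open>Some automorphism carries the edge from \<open>z\<close> to \<open>z'\<close>
      onto the arc from \<open>v\<close> to \<open>w\<close>; the image of \<open>B\<close> meets
      \<open>B\<close> in \<open>v\<close>, hence equals \<open>B\<close>.\<close>
    have neighbour: "w \<in> B" if v: "v \<in> B" "(v, w) \<in> parcs (hypercube_square n)" for v w
    proof -
      obtain f where f: "f \<in> graph_automorphisms (hypercube_square n)" "f z = v" "f z' = w"
        using ex_square_automorphism[of z n z' v w] z z' edge v by (auto simp: parcs_hypercube_square)
      have "B \<inter> f ` B \<noteq> {}"
        using f zB v by force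
      then have "B \<inter> f ` B = B"
        using B f(1) unfolding is_block_def carrier_graph_Aut by blast
      moreover have "card (f ` B) \<le> card B"
        using fin by (rule card_image_le)
      ultimately have "f ` B = B"
        using fin by (metis Int_lower2 card_seteq finite_imageI)
      then show ?thesis
        using f zB by blast
    qed
    \<comment> \<open>Connectedness, by induction on the distance from \<open>x\<close>.\<close>
    have "w \<in> B" if "length w = n" for w
      using that
    proof (induction "square_dist x w" arbitrary: w rule: less_induct)
      case less
      show ?case
      proof (cases "square_dist x w = 0")
        case True
        then show ?thesis
          using less.prems xy len square_dist_eq_0_iff[of x w] by simp
      next
        case False
        then obtain v where "(v, w) \<in> parcs (hypercube_square n)" "square_dist x v < square_dist x w"
          using square_dist_pred[of x n w] less.prems xy len by auto
        then show ?thesis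
          using less.hyps neighbour by (auto simp: parcs_hypercube_square)
      qed
    qed
    then have "B = ?V"
      using sub by auto
    then show ?thesis by simp
  qed
qed

text \<open>For \<open>n = 1\<close> an antipodal pair is the whole vertex set, hence a trivial
  block.\<close>

lemma imprimitive_hypercube_square_odd:
  assumes "odd n" "n \<noteq> 1"
  shows "imprimitive_graph (hypercube_square n)"
  unfolding imprimitive_graph_def
proof (intro imprimitive_action.intro transitive_action_hypercube_square
    imprimitive_action_axioms.intro notI)
  let ?V = "pverts (hypercube_square n)"
  assume "primitive_action (graph_Aut (hypercube_square n)) ?V (\<lambda>f. f)"
  then interpret primitive_action "graph_Aut (hypercube_square n)" ?V "\<lambda>f. f" .
  have antipode: "square_dist xs ys = (n + 1) div 2 \<longleftrightarrow> ys = map Not xs"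
    if "length xs = n" "length ys = n" for xs ys
  proof -
    \<comment> \<open>For odd \<open>n\<close>, Hamming distance \<open>n - 1\<close> is even and is
      not rounded up to \<open>(n + 1) div 2\<close>.\<close>
    have "square_dist xs ys = (n + 1) div 2 \<longleftrightarrow> hamming xs ys = n"
      using hamming_le[of xs ys] that \<open>odd n\<close> by (auto simp: square_dist_def elim!: oddE)
    then show ?thesis
      using hamming_eq_length_iff[of xs ys] that by simp
  qed
  define x where "x = replicate n False"
  define B where "B = {x, map Not x}"
  have len: "length x = n"
    by (simp add: x_def)
  have "is_block (graph_Aut (hypercube_square n)) ?V (\<lambda>f. f) B"
    unfolding is_block_def
  proof (intro conjI ballI)
    show "B \<subseteq> ?V"
      using len by (auto simp: B_def)
    fix f assume "f \<in> carrier (graph_Aut (hypercube_square n))"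
    then have f: "f \<in> graph_automorphisms (hypercube_square n)" by simp
    have "length (f x) = n" "length (f (map Not x)) = n"
      using bij_betwE[OF graph_automorphismsD(1)[OF f]] len by auto
    \<comment> \<open>Automorphisms preserve distance, so they map antipodal pairs to antipodal
      pairs.\<close>
    moreover have "square_dist (f x) (f (map Not x)) = (n + 1) div 2"
      using square_dist_automorphism[OF f, of x "map Not x"] antipode[of x "map Not x"] len by simp
    ultimately have "f (map Not x) = map Not (f x)"
      using antipode by blast
    then have fB: "f ` B = {f x, map Not (f x)}"
      by (simp add: B_def)
    have notnot: "map Not (map Not w) = w" for w :: "bool list"
      by (simp add: comp_def)
    show "B \<inter> f ` B \<in> {B, {}}"
    \<comment> \<open>Two antipodal pairs coincide or are disjoint, because complementing is an
      involution.\<close>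
    proof (cases "f x \<in> B")
      case True
      then have "f ` B = B"
        unfolding fB using notnot[of x] by (auto simp: B_def simp del: map_map)
      then show ?thesis by simp
    next
      case False
      then have "map Not (f x) \<notin> B"
        using notnot[of "f x"] notnot[of x] by (auto simp: B_def simp del: map_map)
      with False show ?thesis
        unfolding fB by simp
    qed
  qed
  then have "card B \<in> {0, 1, card ?V}"
    by (rule block_trivial)
  moreover have "card B = 2"
    using \<open>odd n\<close> by (cases n) (auto simp: B_def x_def)
  moreover have "card ?V = 2 ^ n"
    using card_lists_length_eq[of "UNIV :: bool set" n] by (simp add: card_UNIV_bool)
  \<comment> \<open>A trivial block of size 2 would have to be the whole vertex set.\<close>
  ultimately have "(2 :: nat) ^ n = 2 ^ 1"
    by simp
  then show False
    using \<open>n \<noteq> 1\<close> by (simp only: power_inject_exp)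
qed

theorem corollary3p8:
  fixes n :: nat
  assumes "n \<ge> 4"
  shows "imprimitive_graph (graph_square (hypercube n)) \<and>
           distance_transitive (graph_square (hypercube n)) \<longleftrightarrow> odd n"
proof
  assume "imprimitive_graph (hypercube_square n) \<and> distance_transitive (hypercube_square n)"
  then have "\<not> primitive_graph (hypercube_square n)"
    by (auto simp: imprimitive_graph_def primitive_graph_def imprimitive_action_def
        imprimitive_action_axioms_def)
  then show "odd n"
    using primitive_hypercube_square_even by blast
next
  assume "odd n"
  then show "imprimitive_graph (hypercube_square n) \<and> distance_transitive (hypercube_square n)"
    using imprimitive_hypercube_square_odd distance_transitive_hypercube_square assms by simp
qed

end
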